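(* Let $\mathcal{F}$ be a block filter on $E$. Suppose that for every clopen set $\mathbb{A}\subseteq E^{[\infty]}$ there is $X\in E^{[\infty]}$ with $\langle X\rangle\in\mathcal{F}$ such that either (i) player I has a strategy in $F[X]$ for playing out of $\mathbb{A}$, or (ii) player II has a strategy in $G[X]$ for playing into $\mathbb{A}$. Then $\mathcal{F}$ has the $(p)$-property.
   Context: $E$ is a countably infinite-dimensional vector space over a countable field $F$ with fixed basis $(e_n)$; $\mathrm{supp}(v)$ for nonzero $v$ is the set of $i$ with $e_i$ having nonzero coefficient in $v$. A block sequence is a sequence $(x_n)$ of nonzero vectors with $\max\mathrm{supp}(x_n)<\min\mathrm{supp}(x_{n+1})$; $E^{[\infty]}$ is the set of infinite block sequences, with the Polish topology inherited from $E^\omega$ ($E$ discrete); $\langle X\rangle$ is the span of $X$ minus $0$; $Y\preceq X$ iff $\langle Y\rangle\subseteq\langle X\rangle$; $X/n$ is the tail of $X$ of vectors with support above $n$; $Y\preceq^*X$ iff $Y/n\preceq X$ for some $n$. A filter on $E$ is a proper filter of subsets of $E\setminus\{0\}$ containing nonzero parts of all finite-codimensional subspaces; a block filter has a base of sets $\langle X\rangle$, $X\in E^{[\infty]}$. $\mathcal{F}$ has the $(p)$-property if whenever $\langle X_n\rangle\in\mathcal{F}$ for all $n$, there is $\langle X\rangle\in\mathcal{F}$ with $X\preceq^* X_n$ for all $n$. Asymptotic game $F[X]$: I and II alternate, I first; I plays natural numbers $n_k$, II responds with nonzero vectors $y_k\in\langle X\rangle$ forming a block sequence with $n_k<\min\mathrm{supp}(y_k)$.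 Gowers game $G[X]$: I plays $Y_k\in E^{[\infty]}$ with $Y_k\preceq X$, II responds with $y_k\in\langle Y_k\rangle$ so that $(y_k)$ is a block sequence. The outcome of a round is $(y_k)$. A player has a strategy for playing into (out of) $\mathbb{A}$ if they have a strategy all of whose resulting outcomes lie in (outside) $\mathbb{A}$. *)

theory Defs
  imports Complex_Main "HOL-Analysis.Function_Topology"
begin

locale based_space = vector_space scale
  for scale :: "'f::field \<Rightarrow> 'v::ab_group_add \<Rightarrow> 'v" +
  fixes e :: "nat \<Rightarrow> 'v"
  assumes countable_field: "countable (UNIV :: 'f set)"
    and inj_basis: "inj e"
    and independent_basis: "independent (range e)"
    and span_basis: "span (range e) = UNIV"
begin

definition supp :: "'v \<Rightarrow> nat set" where
  "supp v = {i. representation (range e) v (e i) \<noteq> 0}"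

definition block_seq :: "(nat \<Rightarrow> 'v) \<Rightarrow> bool" where
  "block_seq x \<longleftrightarrow>
     (\<forall>n. x n \<noteq> 0) \<and> (\<forall>n. Max (supp (x n)) < Min (supp (x (Suc n))))"

definition block_topology :: "(nat \<Rightarrow> 'v) topology" where
  "block_topology =
     subtopology (product_topology (\<lambda>_. discrete_topology UNIV) UNIV) {x. block_seq x}"

definition nzspan :: "(nat \<Rightarrow> 'v) \<Rightarrow> 'v set" where
  "nzspan X = span (range X) - {0}"

definition block_le :: "(nat \<Rightarrow> 'v) \<Rightarrow> (nat \<Rightarrow> 'v) \<Rightarrow> bool" where
  "block_le Y X \<longleftrightarrow> nzspan Y \<subseteq> nzspan X"

text \<open>For a block sequence \<open>X\<close>, the vectors supported above \<open>n\<close> are exactly those from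
  the least such index onwards.\<close>

definition block_tail :: "(nat \<Rightarrow> 'v) \<Rightarrow> nat \<Rightarrow> nat \<Rightarrow> 'v" where
  "block_tail X n = (\<lambda>k. X (k + (LEAST m. n < Min (supp (X m)))))"

definition block_le_star :: "(nat \<Rightarrow> 'v) \<Rightarrow> (nat \<Rightarrow> 'v) \<Rightarrow> bool" where
  "block_le_star Y X \<longleftrightarrow> (\<exists>n. block_le (block_tail Y n) X)"

definition finite_codim :: "'v set \<Rightarrow> bool" where
  "finite_codim V \<longleftrightarrow> subspace V \<and> (\<exists>B. finite B \<and> span (V \<union> B) = UNIV)"

definition space_filter :: "'v set set \<Rightarrow> bool" where
  "space_filter \<F> \<longleftrightarrow>
     \<F> \<subseteq> Pow (UNIV - {0}) \<and>
     UNIV - {0} \<in> \<F> \<and>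
     {} \<notin> \<F> \<and>
     (\<forall>A\<in>\<F>. \<forall>B\<in>\<F>. A \<inter> B \<in> \<F>) \<and>
     (\<forall>A\<in>\<F>. \<forall>B. A \<subseteq> B \<and> B \<subseteq> UNIV - {0} \<longrightarrow> B \<in> \<F>) \<and>
     (\<forall>V. finite_codim V \<longrightarrow> V - {0} \<in> \<F>)"

definition block_filter :: "'v set set \<Rightarrow> bool" where
  "block_filter \<F> \<longleftrightarrow>
     space_filter \<F> \<and>
     (\<forall>A\<in>\<F>. \<exists>X. block_seq X \<and> nzspan X \<in> \<F> \<and> nzspan X \<subseteq> A)"

definition p_property :: "'v set set \<Rightarrow> bool" where
  "p_property \<F> \<longleftrightarrow>
     (\<forall>X :: nat \<Rightarrow> nat \<Rightarrow> 'v.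
        (\<forall>n. block_seq (X n) \<and> nzspan (X n) \<in> \<F>) \<longrightarrow>
        (\<exists>Y. block_seq Y \<and> nzspan Y \<in> \<F> \<and> (\<forall>n. block_le_star Y (X n))))"

text \<open>A strategy is a function of the opponent's moves so far.  In the asymptotic game, I's
  \<open>k\<close>-th move is \<open>\<sigma> [y 0, \<dots>, y (k - 1)]\<close>, and \<open>y\<close> ranges over
  the outcomes of all rounds in which II obeys the rules against \<open>\<sigma>\<close>.\<close>

definition asymptotic_outcome ::
  "(nat \<Rightarrow> 'v) \<Rightarrow> ('v list \<Rightarrow> nat) \<Rightarrow> (nat \<Rightarrow> 'v) \<Rightarrow> bool" where
  "asymptotic_outcome X \<sigma> y \<longleftrightarrow>
     block_seq y \<and>
     (\<forall>k. y k \<in> nzspan X \<and> \<sigma> (map y [0..<k]) < Min (supp (y k)))"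

definition I_asymptotic_out_of :: "(nat \<Rightarrow> 'v) \<Rightarrow> (nat \<Rightarrow> 'v) set \<Rightarrow> bool" where
  "I_asymptotic_out_of X \<A> \<longleftrightarrow>
     (\<exists>\<sigma>. \<forall>y. asymptotic_outcome X \<sigma> y \<longrightarrow> y \<notin> \<A>)"

text \<open>In the Gowers game, II answers I's moves \<open>Y 0, \<dots>, Y k\<close> with
  \<open>\<tau> [Y 0, \<dots>, Y k]\<close>.  II must obey the rules, so the legality of the answers is
  part of what a strategy for II has to guarantee.\<close>

definition gowers_outcome ::
  "((nat \<Rightarrow> 'v) list \<Rightarrow> 'v) \<Rightarrow> (nat \<Rightarrow> nat \<Rightarrow> 'v) \<Rightarrow> nat \<Rightarrow> 'v" where
  "gowers_outcome \<tau> Y = (\<lambda>k. \<tau> (map Y [0..<Suc k]))"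

definition II_gowers_into :: "(nat \<Rightarrow> 'v) \<Rightarrow> (nat \<Rightarrow> 'v) set \<Rightarrow> bool" where
  "II_gowers_into X \<A> \<longleftrightarrow>
     (\<exists>\<tau>. \<forall>Y :: nat \<Rightarrow> nat \<Rightarrow> 'v.
        (\<forall>k. block_seq (Y k) \<and> block_le (Y k) X) \<longrightarrow>
        (\<forall>k. gowers_outcome \<tau> Y k \<in> nzspan (Y k)) \<and>
        block_seq (gowers_outcome \<tau> Y) \<and>
        gowers_outcome \<tau> Y \<in> \<A>)"

end

end

theory Submission
  imports Defs
begin

text \<open>
  Given \<open>\<langle>X\<^sub>n\<rangle> \<in> \<F>\<close>, consider the clopen set \<open>\<A>\<close> of block sequences \<open>y\<close> such that
  \<open>y\<^sub>1 \<notin> \<langle>X\<^sub>i\<rangle>\<close> for some \<open>i \<le> min supp y\<^sub>0\<close>. In the Gowers game I defeats any attempt of II to play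
  into \<open>\<A>\<close>: after seeing \<open>y\<^sub>0\<close>, I plays a block sequence whose span lies in the finitely many
  relevant \<open>\<langle>X\<^sub>i\<rangle>\<close>. So I has a strategy in some asymptotic game \<open>F[X]\<close> for playing out of \<open>\<A>\<close>.
  For any first move \<open>y\<^sub>0\<close> with \<open>min supp y\<^sub>0 \<ge> i\<close>, the strategy's next answer then bounds the
  tail of \<open>X\<close> that is contained in \<open>\<langle>X\<^sub>i\<rangle>\<close>.
\<close>

context based_space
begin

lemma finite_supp: "finite (supp v)"
proof -
  have "e ` supp v \<subseteq> {b. representation (range e) v b \<noteq> 0}"
    by (auto simp: supp_def)
  then have "finite (e ` supp v)"
    using finite_representation finite_subset by blast
  then show ?thesis
    using inj_basis finite_imageD inj_on_subset by blast
qed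

text \<open>A vector whose coordinates all vanish equals an empty sum. With finiteness this makes
  \<open>Min\<close> and \<open>Max\<close> of supports meaningful for nonzero vectors.\<close>

lemma supp_nonempty:
  assumes "v \<noteq> 0"
  shows "supp v \<noteq> {}"
proof
  assume "supp v = {}"
  then have zero: "representation (range e) v b = 0" for b
    using representation_ne_zero[of "range e" v b] by (auto simp: supp_def)
  have "(\<Sum>b | representation (range e) v b \<noteq> 0. scale (representation (range e) v b) b) = v"
    using independent_basis by (rule sum_nonzero_representation_eq) (simp add: span_basis)
  with assms zero show False
    by simp
qed

text \<open>Serves to carry a lower bound on supports from the vectors of a block sequence to their
  whole span.\<close>

lemma subspace_supp_subset: "subspace {v. supp v \<subseteq> S}"
proof -
  note rep = independent_basis span_basis
  have "supp (x + y) \<subseteq> supp x \<union> supp y" for x y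
    by (auto simp: supp_def representation_add rep)
  moreover have "supp (scale c x) \<subseteq> supp x" for c x
    by (auto simp: supp_def representation_scale rep)
  moreover have "supp 0 = {}"
    by (simp add: supp_def representation_zero)
  ultimately show ?thesis
    unfolding subspace_def by blast
qed

lemma Min_supp_greater_iff:
  assumes "v \<noteq> 0"
  shows "n < Min (supp v) \<longleftrightarrow> supp v \<subseteq> {n<..}"
  using assms finite_supp supp_nonempty by auto

lemma Min_supp_le_Max_supp: "v \<noteq> 0 \<Longrightarrow> Min (supp v) \<le> Max (supp v)"
  using finite_supp supp_nonempty by (meson Max_ge Min_in)

lemma strict_mono_Min_supp:
  assumes "block_seq X"
  shows "strict_mono (\<lambda>k. Min (supp (X k)))"
  using assms Min_supp_le_Max_supp unfolding block_seq_def strict_mono_Suc_iff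
  by (meson le_less_trans)

lemma ex_Min_supp_greater:
  assumes "block_seq X"
  shows "\<exists>k. n < Min (supp (X k))"
  using strict_mono_imp_increasing[OF strict_mono_Min_supp[OF assms], of "Suc n"]
  by (auto simp: Suc_le_eq)

lemma block_seq_in_nzspan: "block_seq X \<Longrightarrow> X k \<in> nzspan X"
  by (simp add: nzspan_def block_seq_def span_base)

lemma nzspan_block_tail:
  assumes X: "block_seq X" and v: "v \<in> nzspan (block_tail X n)"
  shows "v \<in> nzspan X" and "n < Min (supp v)"
proof -
  have "range (block_tail X n) \<subseteq> range X"
    by (auto simp: block_tail_def)
  then show "v \<in> nzspan X"
    using v span_mono by (auto simp: nzspan_def)
  define m where "m = (LEAST m. n < Min (supp (X m)))"
  have m: "n < Min (supp (X m))"
    unfolding m_def using ex_Min_supp_greater[OF X] by (rule LeastI_ex)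
  have "n < Min (supp (X (k + m)))" for k
    using m strict_mono_less_eq[OF strict_mono_Min_supp[OF X], of m "k + m"] by simp
  then have "range (block_tail X n) \<subseteq> {v. supp v \<subseteq> {n<..}}"
    using X Min_supp_greater_iff by (auto simp: block_tail_def m_def block_seq_def)
  then have "span (range (block_tail X n)) \<subseteq> {v. supp v \<subseteq> {n<..}}"
    using subspace_supp_subset by (rule span_minimal)
  then show "n < Min (supp v)"
    using v Min_supp_greater_iff by (auto simp: nzspan_def)
qed

lemma openin_block_topology_two_coordinates:
  "openin block_topology {y. block_seq y \<and> P (y 0) (y 1)}"
proof -
  let ?T = "product_topology (\<lambda>_. discrete_topology UNIV) UNIV :: (nat \<Rightarrow> 'v) topology"
  have "openin ?T {y. P (y 0) (y 1)}"
  proof (subst openin_subopen, intro ballI)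
    fix y :: "nat \<Rightarrow> 'v" assume y: "y \<in> {y. P (y 0) (y 1)}"
    \<comment> \<open>The basic neighbourhood of \<open>y\<close> that freezes coordinates 0 and 1
      only.\<close>
    let ?U = "\<Pi>\<^sub>E i\<in>UNIV. if i < 2 then {y i} else UNIV"
    have "openin ?T ?U"
      by (rule product_topology_basis) (auto intro: finite_subset[of _ "{..<2}"])
    moreover have "?U \<subseteq> {y. P (y 0) (y 1)}"
    proof
      fix z assume "z \<in> ?U"
      then have "z i \<in> (if i < 2 then {y i} else UNIV)" for i
        by (rule PiE_mem) simp
      from this[of 0] this[of 1] y show "z \<in> {y. P (y 0) (y 1)}"
        by simp
    qed
    moreover have "y \<in> ?U"
      by auto
    ultimately show "\<exists>U. openin ?T U \<and> y \<in> U \<and> U \<subseteq> {y. P (y 0) (y 1)}"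
      by blast
  qed
  then show ?thesis
    unfolding block_topology_def openin_subtopology by (intro exI conjI) auto
qed

text \<open>The complement among block sequences has the same shape, with \<open>P\<close>
  negated.\<close>

lemma closedin_block_topology_two_coordinates:
  "closedin block_topology {y. block_seq y \<and> P (y 0) (y 1)}"
proof -
  have top: "topspace block_topology = {y. block_seq y}"
    by (auto simp: block_topology_def)
  have "{y. block_seq y} - {y. block_seq y \<and> P (y 0) (y 1)}
      = {y. block_seq y \<and> \<not> P (y 0) (y 1)}"
    by auto
  then show ?thesis
    using openin_block_topology_two_coordinates[of "\<lambda>a b. \<not> P a b"]
    by (auto simp: closedin_def top)
qed

text \<open>A strategy of I is judged on infinite rounds only, so two legal moves of II must be
  prolonged to a full round. This is possible because the supports in \<open>X\<close> go
  arbitrarily far out.\<close>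

lemma asymptotic_outcome_extending:
  assumes X: "block_seq X"
    and u: "u \<in> nzspan X" "\<sigma> [] < Min (supp u)"
    and v: "v \<in> nzspan X" "\<sigma> [u] < Min (supp v)" "Max (supp u) < Min (supp v)"
  obtains y where "asymptotic_outcome X \<sigma> y" "y 0 = u" "y 1 = v"
proof -
  define P where "P y n r \<longleftrightarrow> (n = 0 \<longrightarrow> r = u) \<and> (n = 1 \<longrightarrow> r = v) \<and> r \<in> nzspan X \<and>
      \<sigma> (map y [0..<n]) < Min (supp r) \<and> (\<forall>m. n = Suc m \<longrightarrow> Max (supp (y m)) < Min (supp r))"
    for y :: "nat \<Rightarrow> 'v" and n r
  have "\<exists>y. \<forall>n. P y n (y n)"
  \<comment> \<open>Course-of-values recursion: I's \<open>n\<close>-th move depends on all earlier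
    answers \<open>y 0\<close>, ..., \<open>y (n - 1)\<close>.\<close>
  proof (rule dependent_wellorder_choice)
    fix r and f g :: "nat \<Rightarrow> 'v" and n :: nat
    assume eq: "\<And>m. m < n \<Longrightarrow> f m = g m"
    then have hist: "map f [0..<n] = map g [0..<n]"
      by simp
    show "P f n r = P g n r"
      unfolding P_def hist using eq by auto
  next
    fix n :: nat and f assume IH: "\<And>m. m < n \<Longrightarrow> P f m (f m)"
    show "\<exists>r. P f n r"
    proof (cases "n < 2")
      case True
      then consider "n = 0" | "n = 1"
        by linarith
      then show ?thesis
      proof cases
        case 1
        then have "P f n u"
          using u by (simp add: P_def)
        then show ?thesis ..
      next
        case 2
        then have "f 0 = u"
          using IH[of 0] by (simp add: P_def)
        then have "P f n v"
          using v 2 by (simp add: P_def)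
        then show ?thesis ..
      qed
    next
      case False
      \<comment> \<open>From the third move on, II plays a vector of \<open>X\<close> beyond both
        I's number and the previous answer.\<close>
      obtain j where "max (\<sigma> (map f [0..<n])) (Max (supp (f (n - 1)))) < Min (supp (X j))"
        using ex_Min_supp_greater[OF X] by blast
      then have "P f n (X j)"
        using False block_seq_in_nzspan[OF X] by (auto simp: P_def)
      then show ?thesis ..
    qed
  qed
  then obtain y where y: "\<And>n. P y n (y n)"
    by blast
  then have "asymptotic_outcome X \<sigma> y"
    by (auto simp: P_def asymptotic_outcome_def block_seq_def nzspan_def)
  moreover have "y 0 = u" "y 1 = v"
    using y[of 0] y[of 1] by (simp_all add: P_def)
  ultimately show thesis
    using that by blast
qed

lemma filter_INT_atMost:
  fixes n :: nat
  assumes "space_filter \<F>" and "\<And>i. A i \<in> \<F>"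
  shows "(\<Inter>i\<le>n. A i) \<in> \<F>"
  using assms by (induction n) (auto simp: atMost_Suc space_filter_def)

text \<open>I opens with \<open>X\<close>, sees II's answer \<open>u\<close>, and then plays a block
  sequence spanning inside \<open>S u\<close>, which the base of the block filter supplies.\<close>

lemma not_II_gowers_into:
  assumes filt: "block_filter \<F>" and X: "block_seq X" "nzspan X \<in> \<F>"
    and S: "\<And>u. S u \<in> \<F>"
  shows "\<not> II_gowers_into X {y. block_seq y \<and> y 1 \<notin> S (y 0)}"
proof
  assume "II_gowers_into X {y. block_seq y \<and> y 1 \<notin> S (y 0)}"
  then obtain \<tau> where \<tau>: "\<And>Y. (\<And>k. block_seq (Y k) \<and> block_le (Y k) X) \<Longrightarrow>
      (\<forall>k. gowers_outcome \<tau> Y k \<in> nzspan (Y k)) \<and>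
      gowers_outcome \<tau> Y 1 \<notin> S (gowers_outcome \<tau> Y 0)"
    unfolding II_gowers_into_def by blast
  have "nzspan X \<inter> S (\<tau> [X]) \<in> \<F>"
    using filt X(2) S by (auto simp: block_filter_def space_filter_def)
  then obtain Z where Z: "block_seq Z" "nzspan Z \<subseteq> nzspan X \<inter> S (\<tau> [X])"
    using filt unfolding block_filter_def by blast
  \<comment> \<open>II's first answer \<open>\<tau> [X]\<close> depends on the opening move alone,
    so \<open>Z\<close> could be chosen after it.\<close>
  define Y where "Y k = (if k = 0 then X else Z)" for k :: nat
  have legal: "block_seq (Y k) \<and> block_le (Y k) X" for k
    using X Z by (auto simp: Y_def block_le_def)
  have "gowers_outcome \<tau> Y 0 = \<tau> [X]"
    by (simp add: gowers_outcome_def Y_def)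
  moreover have "gowers_outcome \<tau> Y 1 \<in> nzspan (Y 1)"
    using \<tau>[of Y, OF legal] by blast
  then have "gowers_outcome \<tau> Y 1 \<in> S (\<tau> [X])"
    using Z(2) by (auto simp: Y_def)
  ultimately show False
    using \<tau>[of Y, OF legal] by simp
qed

lemma p_property_if_clopen_dichotomy:
  assumes filt: "block_filter \<F>"
    and dich: "\<And>\<A>. openin block_topology \<A> \<Longrightarrow> closedin block_topology \<A> \<Longrightarrow>
      \<exists>X. block_seq X \<and> nzspan X \<in> \<F> \<and> (I_asymptotic_out_of X \<A> \<or> II_gowers_into X \<A>)"
  shows "p_property \<F>"
  unfolding p_property_def
proof (intro allI impI)
  fix X :: "nat \<Rightarrow> nat \<Rightarrow> 'v"
  assume X: "\<forall>n. block_seq (X n) \<and> nzspan (X n) \<in> \<F>"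
  \<comment> \<open>Stopping at \<open>Min (supp u)\<close> keeps the intersection finite, hence in
    the filter, while vectors \<open>u\<close> far enough out reach any given index.\<close>
  define S where "S u = (\<Inter>i\<le>Min (supp u). nzspan (X i))" for u
  let ?A = "{y. block_seq y \<and> y 1 \<notin> S (y 0)}"
  have S: "S u \<in> \<F>" for u
    unfolding S_def using filt X by (intro filter_INT_atMost) (auto simp: block_filter_def)
  obtain Y where Y: "block_seq Y" "nzspan Y \<in> \<F>"
    and "I_asymptotic_out_of Y ?A \<or> II_gowers_into Y ?A"
    using dich[OF openin_block_topology_two_coordinates
        closedin_block_topology_two_coordinates, of "\<lambda>a b. b \<notin> S a"] by blast
  then obtain \<sigma> where \<sigma>: "\<And>y. asymptotic_outcome Y \<sigma> y \<Longrightarrow> y \<notin> ?A"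
    using not_II_gowers_into[where S = S, OF filt Y S] unfolding I_asymptotic_out_of_def by blast
  have "block_le_star Y (X i)" for i
  proof -
    \<comment> \<open>\<open>Y k\<close> is then a legal first answer, and \<open>X i\<close> is
      among the sequences entering \<open>S (Y k)\<close>.\<close>
    obtain k where k: "max i (\<sigma> []) < Min (supp (Y k))"
      using ex_Min_supp_greater[OF Y(1)] by blast
    \<comment> \<open>Beyond this bound, which is independent of \<open>v\<close>, every vector of
      the span of \<open>Y\<close> is a legal second answer after \<open>Y k\<close>.\<close>
    define m where "m = max (\<sigma> [Y k]) (Max (supp (Y k)))"
    have "v \<in> nzspan (X i)" if "v \<in> nzspan (block_tail Y m)" for v
    proof -
      note v = nzspan_block_tail[OF Y(1) that]
      obtain y where y: "asymptotic_outcome Y \<sigma> y" "y 0 = Y k" "y 1 = v"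
        using asymptotic_outcome_extending[OF Y(1) block_seq_in_nzspan[OF Y(1)], of \<sigma> k v] k v
        by (auto simp: m_def)
      then have "v \<in> S (Y k)"
        using \<sigma>[OF y(1)] by (auto simp: asymptotic_outcome_def)
      then show ?thesis
        using k by (auto simp: S_def)
    qed
    then show ?thesis
      by (auto simp: block_le_star_def block_le_def)
  qed
  then show "\<exists>Y. block_seq Y \<and> nzspan Y \<in> \<F> \<and> (\<forall>n. block_le_star Y (X n))"
    using Y by blast
qed

end

theorem theorem4p1:
  fixes scale :: "'f::field \<Rightarrow> 'v::ab_group_add \<Rightarrow> 'v"
    and e :: "nat \<Rightarrow> 'v"
    and \<F> :: "'v set set"
  assumes "based_space scale e"
    and "based_space.block_filter scale e \<F>"
    and "\<And>\<A> :: (nat \<Rightarrow> 'v) set.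
           openin (based_space.block_topology scale e) \<A> \<Longrightarrow>
           closedin (based_space.block_topology scale e) \<A> \<Longrightarrow>
           \<exists>X. based_space.block_seq scale e X \<and> based_space.nzspan scale X \<in> \<F> \<and>
               (based_space.I_asymptotic_out_of scale e X \<A> \<or>
                based_space.II_gowers_into scale e X \<A>)"
  shows "based_space.p_property scale e \<F>"
  using assms by (rule based_space.p_property_if_clopen_dichotomy)

end
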